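(* Let $\Xi$ be a class of designs on $\mathcal{X}$. For $\nu\in[0,1]$ let $\xi_\nu=\arg\min_{\xi\in\Xi} I_\nu(\xi)$, where $I_\nu(\xi)=(1-\nu)\,\mathrm{VAR}(\xi)+\nu\,\mathrm{MAXBIAS}(\xi)$, and put $b^2(\nu)=\mathrm{MAXBIAS}(\xi_\nu)$ and $s^2(\nu)=\mathrm{VAR}(\xi_\nu)$. (a) Robust Bounded Bias designs with bias bound $b^2$ satisfying $\min_{\xi\in\Xi}\mathrm{MAXBIAS}(\xi)\le b^2\le \max_{\xi\in\Xi}\mathrm{MAXBIAS}(\xi)$ are given by $$\xi=\begin{cases}\xi_\nu, & \text{if } b^2=b^2(\nu),\ \text{for } 0\le\nu\le 1;\\ \xi_0, & \text{if } b^2\ge b^2(0).\end{cases}$$ (b) Robust Bounded Variance designs with variance bound $s^2$ satisfying $\min_{\xi\in\Xi}\mathrm{VAR}(\xi)\le s^2\le \max_{\xi\in\Xi}\mathrm{VAR}(\xi)$ are given by $$\xi=\begin{cases}\xi_\nu, & \text{if } s^2=s^2(\nu),\ \text{for } 0\le\nu\le 1;\\ \xi_1, & \text{if } s^2\ge s^2(1).\end{cases}$$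
   Context: Setting. $\mathcal{X}$ is a design space (a set of values of $q$ independent variables $\boldsymbol x$) and $\mu$ is Lebesgue measure or counting measure on $\mathcal{X}$, depending on the nature of $\mathcal{X}$, with $\int_{\mathcal X}\mu(d\boldsymbol x)<\infty$. $\boldsymbol f$ is a given $p$-vector of regressors, each a function of $\boldsymbol x\in\mathcal X$, such that the $p\times p$ matrix $\boldsymbol A=\int_{\mathcal X}\boldsymbol f(\boldsymbol x)\boldsymbol f'(\boldsymbol x)\,\mu(d\boldsymbol x)$ is invertible (a prime denotes transpose). Designs. A design is identified with its design measure, a probability measure $\xi$ on $\mathcal X$, assumed to be such that $\boldsymbol M_\xi=\int_{\mathcal X}\boldsymbol f(\boldsymbol x)\boldsymbol f'(\boldsymbol x)\,\xi(d\boldsymbol x)$ is invertible. $\Xi$ is a class of designs, for instance all probability measures on $[-1,1]$, or all exact designs (i.e. with integer allocations) on a finite design space. Variance and bias. For a design $\xi$, $\mathrm{VAR}(\xi)=\mathrm{tr}(\boldsymbol A\boldsymbol M_\xi^{-1})$, which is proportional to the integrated variance of the predictors. For a function $\psi_0$ on $\mathcal X$ put $\boldsymbol b_{\psi_0,\xi}=\int_{\mathcal X}\boldsymbol f(\boldsymbol x)\psi_0(\boldsymbol x)\,\xi(d\boldsymbol x)$ and $$\mathrm{BIAS}(\xi\mid\psi_0)=\boldsymbol b_{\psi_0,\xi}'\boldsymbol M_\xi^{-1}\boldsymbol A\boldsymbol M_\xi^{-1}\boldsymbol b_{\psi_0,\xi}+1,$$ the integrated (squared) bias. Then $\mathrm{MAXBIAS}(\xi)=\max_{\psi_0}\mathrm{BIAS}(\xi\mid\psi_0)$,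 with $\psi_0$ constrained by $\int_{\mathcal X}\boldsymbol f(\boldsymbol x)\psi_0(\boldsymbol x)\,\mu(d\boldsymbol x)=\boldsymbol 0$ and $\int_{\mathcal X}\psi_0^2(\boldsymbol x)\,\mu(d\boldsymbol x)=1$. In particular $I_0(\xi)=\mathrm{VAR}(\xi)$ and $I_1(\xi)=\mathrm{MAXBIAS}(\xi)$. Optimization problems. A Robust Bounded Bias design with bias bound $b^2$ is a design that minimizes $\mathrm{VAR}(\xi)$ in the class $\Xi_b\subset\Xi$ of designs for which $\mathrm{MAXBIAS}(\xi)\le b^2$. A Robust Bounded Variance design with variance bound $s^2$ is a design that minimizes $\mathrm{MAXBIAS}(\xi)$ in the class $\Xi_s\subset\Xi$ of designs for which $\mathrm{VAR}(\xi)\le s^2$. *)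

theory Defs
  imports "HOL-Probability.Probability"
begin

definition moment_integrand :: "('a \<Rightarrow> real ^ 'p) \<Rightarrow> 'a \<Rightarrow> real ^ 'p ^ 'p" where
  "moment_integrand f x = (\<chi> i j. f x $ i * f x $ j)"

text \<open>Applied to the reference measure this is the matrix \<open>A\<close>, applied to a design measure it
  is \<open>M\<close>.\<close>

definition moment_matrix :: "('a \<Rightarrow> real ^ 'p) \<Rightarrow> 'a measure \<Rightarrow> real ^ 'p ^ 'p" where
  "moment_matrix f N = (\<integral>x. moment_integrand f x \<partial>N)"

definition regular_moments :: "('a \<Rightarrow> real ^ 'p) \<Rightarrow> 'a measure \<Rightarrow> bool" where
  "regular_moments f N \<longleftrightarrow> integrable N (moment_integrand f) \<and> invertible (moment_matrix f N)"

text \<open>A design need not be absolutely continuous with respect to \<open>\<mu>\<close>; it only shares its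
  measurable sets.\<close>

definition is_design :: "'a measure \<Rightarrow> ('a \<Rightarrow> real ^ 'p) \<Rightarrow> 'a measure \<Rightarrow> bool" where
  "is_design \<mu> f \<xi> \<longleftrightarrow> prob_space \<xi> \<and> sets \<xi> = sets \<mu> \<and> regular_moments f \<xi>"

definition VAR :: "'a measure \<Rightarrow> ('a \<Rightarrow> real ^ 'p) \<Rightarrow> 'a measure \<Rightarrow> real" where
  "VAR \<mu> f \<xi> = trace (moment_matrix f \<mu> ** matrix_inv (moment_matrix f \<xi>))"

definition bias_vector :: "('a \<Rightarrow> real ^ 'p) \<Rightarrow> 'a measure \<Rightarrow> ('a \<Rightarrow> real) \<Rightarrow> real ^ 'p" where
  "bias_vector f \<xi> \<psi> = (\<integral>x. \<psi> x *\<^sub>R f x \<partial>\<xi>)"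

definition BIAS :: "'a measure \<Rightarrow> ('a \<Rightarrow> real ^ 'p) \<Rightarrow> 'a measure \<Rightarrow> ('a \<Rightarrow> real) \<Rightarrow> real" where
  "BIAS \<mu> f \<xi> \<psi> =
     bias_vector f \<xi> \<psi> \<bullet>
       ((matrix_inv (moment_matrix f \<xi>) ** moment_matrix f \<mu> ** matrix_inv (moment_matrix f \<xi>))
          *v bias_vector f \<xi> \<psi>) + 1"

definition contaminations :: "'a measure \<Rightarrow> ('a \<Rightarrow> real ^ 'p) \<Rightarrow> ('a \<Rightarrow> real) set" where
  "contaminations \<mu> f = {\<psi> \<in> borel_measurable \<mu>.
     has_bochner_integral \<mu> (\<lambda>x. \<psi> x *\<^sub>R f x) 0 \<and>
     has_bochner_integral \<mu> (\<lambda>x. (\<psi> x)\<^sup>2) 1}"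

text \<open>The maximum is taken in the extended reals: it is infinite, for instance, for a design with
  finite support in an interval with Lebesgue measure, because \<open>\<psi>\<close> is then
  unconstrained on the support. Only those \<open>\<psi>\<close> compete for which the bias vector of
  the design exists.\<close>

definition MAXBIAS :: "'a measure \<Rightarrow> ('a \<Rightarrow> real ^ 'p) \<Rightarrow> 'a measure \<Rightarrow> ereal" where
  "MAXBIAS \<mu> f \<xi> =
     (SUP \<psi> \<in> {\<psi> \<in> contaminations \<mu> f. integrable \<xi> (\<lambda>x. \<psi> x *\<^sub>R f x)}.
        ereal (BIAS \<mu> f \<xi> \<psi>))"

text \<open>As zero times infinity is zero in the extended reals, \<open>I_crit \<mu> f 0\<close> is the
  variance also where the maximal bias is infinite.\<close>

definition I_crit :: "'a measure \<Rightarrow> ('a \<Rightarrow> real ^ 'p) \<Rightarrow> real \<Rightarrow> 'a measure \<Rightarrow> ereal" where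
  "I_crit \<mu> f \<nu> \<xi> = ereal (1 - \<nu>) * ereal (VAR \<mu> f \<xi>) + ereal \<nu> * MAXBIAS \<mu> f \<xi>"

definition I_optimal ::
  "'a measure \<Rightarrow> ('a \<Rightarrow> real ^ 'p) \<Rightarrow> 'a measure set \<Rightarrow> real \<Rightarrow> 'a measure \<Rightarrow> bool" where
  "I_optimal \<mu> f \<Xi> \<nu> = is_arg_min (I_crit \<mu> f \<nu>) (\<lambda>\<xi>. \<xi> \<in> \<Xi>)"

definition robust_bounded_bias ::
  "'a measure \<Rightarrow> ('a \<Rightarrow> real ^ 'p) \<Rightarrow> 'a measure set \<Rightarrow> real \<Rightarrow> 'a measure \<Rightarrow> bool" where
  "robust_bounded_bias \<mu> f \<Xi> b =
     is_arg_min (VAR \<mu> f) (\<lambda>\<xi>. \<xi> \<in> \<Xi> \<and> MAXBIAS \<mu> f \<xi> \<le> ereal (b\<^sup>2))"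

definition robust_bounded_variance ::
  "'a measure \<Rightarrow> ('a \<Rightarrow> real ^ 'p) \<Rightarrow> 'a measure set \<Rightarrow> real \<Rightarrow> 'a measure \<Rightarrow> bool" where
  "robust_bounded_variance \<mu> f \<Xi> s =
     is_arg_min (MAXBIAS \<mu> f) (\<lambda>\<xi>. \<xi> \<in> \<Xi> \<and> VAR \<mu> f \<xi> \<le> s\<^sup>2)"

end

theory Submission
  imports Defs
begin

text \<open>
  The theorem is the scalarization principle for two competing criteria, the variance and the
  maximal bias. Let \<open>\<xi>\<^sub>\<nu>\<close> minimize the weighted sum of both. If \<open>\<eta>\<close>
  respects the bound that \<open>\<xi>\<^sub>\<nu>\<close> attains in one criterion, this criterion contributes
  no more to the weighted sum at \<open>\<eta>\<close> than at \<open>\<xi>\<^sub>\<nu>\<close>, so the other one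
  must contribute at least as much (\<open>weighted_minimizer_cancel\<close>). Conversely, a solution of
  the problem with this bound is at least as good as \<open>\<xi>\<^sub>\<nu>\<close> in both criteria and
  hence minimizes the weighted sum too (\<open>I_optimal_if_dominates\<close>). A bound so large that it
  is respected by a design that minimizes the other criterion without any constraint
  (\<open>\<xi>\<^sub>0\<close> for bounded bias, \<open>\<xi>\<^sub>1\<close> for bounded variance) does not bind:
  the constrained and the unconstrained minimum coincide.

  The first argument needs a positive weight on the criterion that is minimized, and so leaves out
  one endpoint when the bound is attained: \<open>\<nu> = 1\<close> for bounded bias,
  \<open>\<nu> = 0\<close> for bounded variance. There \<open>\<xi>\<^sub>\<nu>\<close> minimizes the
  bounded criterion alone, every competitor that respects the bound also minimizes it, and the competitors differ at most in the other criterion. It is exactly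
  the uniqueness of \<open>s\<^sup>2(1)\<close> and of \<open>b\<^sup>2(0)\<close> that excludes such a difference.

  The maximal bias may be infinite, with either sign, which restricts the cancellation in the weighted
  sum: only the criterion that is bounded is cancelled, and it is finite at \<open>\<xi>\<^sub>\<nu>\<close>,
  since there it equals the bound.
\<close>

lemma I_crit_0: "I_crit \<mu> f 0 \<eta> = ereal (VAR \<mu> f \<eta>)"
  by (simp add: I_crit_def flip: zero_ereal_def one_ereal_def)

lemma I_crit_1: "I_crit \<mu> f 1 \<eta> = MAXBIAS \<mu> f \<eta>"
  by (simp add: I_crit_def flip: zero_ereal_def one_ereal_def)

lemma I_crit_mono:
  assumes "\<nu> \<in> {0..1}"
    and "VAR \<mu> f \<eta> \<le> VAR \<mu> f \<zeta>"
    and "MAXBIAS \<mu> f \<eta> \<le> MAXBIAS \<mu> f \<zeta>"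
  shows "I_crit \<mu> f \<nu> \<eta> \<le> I_crit \<mu> f \<nu> \<zeta>"
  unfolding I_crit_def using assms
  by (intro add_mono ereal_mult_left_mono) auto

lemma I_optimal_iff:
  "I_optimal \<mu> f \<Xi> \<nu> \<zeta> \<longleftrightarrow>
     \<zeta> \<in> \<Xi> \<and> (\<forall>\<eta>\<in>\<Xi>. I_crit \<mu> f \<nu> \<zeta> \<le> I_crit \<mu> f \<nu> \<eta>)"
  by (auto simp: I_optimal_def is_arg_min_linorder)

lemma robust_bounded_bias_iff:
  "robust_bounded_bias \<mu> f \<Xi> b \<zeta> \<longleftrightarrow>
     \<zeta> \<in> \<Xi> \<and> MAXBIAS \<mu> f \<zeta> \<le> ereal (b\<^sup>2) \<and>
     (\<forall>\<eta>\<in>\<Xi>. MAXBIAS \<mu> f \<eta> \<le> ereal (b\<^sup>2) \<longrightarrow> VAR \<mu> f \<zeta> \<le> VAR \<mu> f \<eta>)"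
  by (auto simp: robust_bounded_bias_def is_arg_min_linorder)

lemma robust_bounded_variance_iff:
  "robust_bounded_variance \<mu> f \<Xi> s \<zeta> \<longleftrightarrow>
     \<zeta> \<in> \<Xi> \<and> VAR \<mu> f \<zeta> \<le> s\<^sup>2 \<and>
     (\<forall>\<eta>\<in>\<Xi>. VAR \<mu> f \<eta> \<le> s\<^sup>2 \<longrightarrow> MAXBIAS \<mu> f \<zeta> \<le> MAXBIAS \<mu> f \<eta>)"
  by (auto simp: robust_bounded_variance_def is_arg_min_linorder)

lemma I_optimal_if_le:
  assumes "I_optimal \<mu> f \<Xi> \<nu> \<zeta>" and "\<eta> \<in> \<Xi>"
    and "I_crit \<mu> f \<nu> \<eta> \<le> I_crit \<mu> f \<nu> \<zeta>"
  shows "I_optimal \<mu> f \<Xi> \<nu> \<eta>"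
  using assms unfolding I_optimal_iff by (meson order_trans)

lemma I_optimal_if_dominates:
  assumes "I_optimal \<mu> f \<Xi> \<nu> \<zeta>" and "\<nu> \<in> {0..1}" and "\<eta> \<in> \<Xi>"
    and "VAR \<mu> f \<eta> \<le> VAR \<mu> f \<zeta>"
    and "MAXBIAS \<mu> f \<eta> \<le> MAXBIAS \<mu> f \<zeta>"
  shows "I_optimal \<mu> f \<Xi> \<nu> \<eta>"
  by (rule I_optimal_if_le[OF assms(1,3) I_crit_mono[OF assms(2,4,5)]])

text \<open>Here \<open>c\<close> is the criterion to be minimized, at the minimizer \<open>x\<close> and at a
  competitor \<open>y\<close>; \<open>r\<close> is the value of the bounded criterion at \<open>x\<close>, which
  serves as the bound, and \<open>k\<close> its value at \<open>y\<close>. Replacing \<open>k\<close> by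
  \<open>r\<close> on the right makes the second summands equal, and as \<open>r\<close> is real they cancel
  even where the criteria are infinite.\<close>

lemma weighted_minimizer_cancel:
  fixes c\<^sub>x c\<^sub>y k :: ereal and w t r :: real
  assumes le: "ereal w * c\<^sub>x + ereal t * ereal r \<le> ereal w * c\<^sub>y + ereal t * k"
    and w: "0 < w" and t: "0 \<le> t" and k: "k \<le> ereal r"
  shows "c\<^sub>x \<le> c\<^sub>y"
proof -
  have "ereal t * k \<le> ereal t * ereal r"
    using k t by (intro ereal_mult_left_mono) auto
  then have "ereal w * c\<^sub>x + ereal (t * r) \<le> ereal w * c\<^sub>y + ereal (t * r)"
    using order_trans[OF le add_left_mono] by simp
  then have "ereal w * c\<^sub>x \<le> ereal w * c\<^sub>y"
    by (simp add: ereal_add_le_add_iff2)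
  then show ?thesis
    using w by (simp add: ereal_mult_le_mult_iff)
qed

text \<open>For \<open>\<nu> = 1\<close> the competitors within the bound minimize the maximal bias just as
  \<open>\<zeta>\<close> does, and uniqueness of the variance among these minimizers takes the place of the
  cancellation.\<close>

lemma VAR_le_if_I_optimal:
  assumes opt: "I_optimal \<mu> f \<Xi> \<nu> \<zeta>" and \<nu>: "\<nu> \<in> {0..1}"
    and bound: "MAXBIAS \<mu> f \<zeta> = ereal r"
    and \<eta>: "\<eta> \<in> \<Xi>" "MAXBIAS \<mu> f \<eta> \<le> ereal r"
    and unique: "\<And>\<eta>. I_optimal \<mu> f \<Xi> 1 \<eta> \<Longrightarrow> VAR \<mu> f \<eta> = v"
  shows "VAR \<mu> f \<zeta> \<le> VAR \<mu> f \<eta>"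
proof (cases "\<nu> = 1")
  case True
  with opt have "I_optimal \<mu> f \<Xi> 1 \<zeta>" by simp
  moreover from this have "I_optimal \<mu> f \<Xi> 1 \<eta>"
    by (rule I_optimal_if_le) (use \<eta> bound in \<open>simp_all add: I_crit_1\<close>)
  ultimately show ?thesis by (simp add: unique)
next
  case False
  have "I_crit \<mu> f \<nu> \<zeta> \<le> I_crit \<mu> f \<nu> \<eta>"
    using opt \<eta> by (simp add: I_optimal_iff)
  then have "ereal (VAR \<mu> f \<zeta>) \<le> ereal (VAR \<mu> f \<eta>)"
    unfolding I_crit_def bound
    by (rule weighted_minimizer_cancel) (use \<nu> False \<eta> in auto)
  then show ?thesis by simp
qed

text \<open>The same with the criteria exchanged, so that the exceptional weight is
  \<open>\<nu> = 0\<close>.\<close>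

lemma MAXBIAS_le_if_I_optimal:
  assumes opt: "I_optimal \<mu> f \<Xi> \<nu> \<zeta>" and \<nu>: "\<nu> \<in> {0..1}"
    and \<eta>: "\<eta> \<in> \<Xi>" "VAR \<mu> f \<eta> \<le> VAR \<mu> f \<zeta>"
    and unique: "\<And>\<eta>. I_optimal \<mu> f \<Xi> 0 \<eta> \<Longrightarrow> MAXBIAS \<mu> f \<eta> = v"
  shows "MAXBIAS \<mu> f \<zeta> \<le> MAXBIAS \<mu> f \<eta>"
proof (cases "\<nu> = 0")
  case True
  with opt have "I_optimal \<mu> f \<Xi> 0 \<zeta>" by simp
  moreover from this have "I_optimal \<mu> f \<Xi> 0 \<eta>"
    by (rule I_optimal_if_le) (use \<eta> in \<open>simp_all add: I_crit_0\<close>)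
  ultimately show ?thesis by (simp add: unique)
next
  case False
  have "I_crit \<mu> f \<nu> \<zeta> \<le> I_crit \<mu> f \<nu> \<eta>"
    using opt \<eta> by (simp add: I_optimal_iff)
  then have "ereal \<nu> * MAXBIAS \<mu> f \<zeta> + ereal (1 - \<nu>) * ereal (VAR \<mu> f \<zeta>)
      \<le> ereal \<nu> * MAXBIAS \<mu> f \<eta> + ereal (1 - \<nu>) * ereal (VAR \<mu> f \<eta>)"
    by (simp only: I_crit_def add.commute)
  then show ?thesis
    by (rule weighted_minimizer_cancel) (use \<nu> False \<eta> in auto)
qed

theorem theorem1:
  fixes X :: "(real ^ 'q) set"
    and \<mu> :: "(real ^ 'q) measure"
    and f :: "real ^ 'q \<Rightarrow> real ^ 'p"
    and \<Xi> :: "(real ^ 'q) measure set"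
    and \<xi> :: "real \<Rightarrow> (real ^ 'q) measure"
  assumes mu: "(X \<in> sets borel \<and> \<mu> = restrict_space lborel X) \<or> \<mu> = count_space X"
    and fin: "finite_measure \<mu>"
    and meas: "f \<in> borel_measurable \<mu>"
    and A_inv: "regular_moments f \<mu>"
    and designs: "\<And>\<eta>. \<eta> \<in> \<Xi> \<Longrightarrow> is_design \<mu> f \<eta>"
    and opt: "\<And>\<nu>. \<nu> \<in> {0..1} \<Longrightarrow> I_optimal \<mu> f \<Xi> \<nu> (\<xi> \<nu>)"
    \<comment> \<open>\<open>b\<^sup>2(0)\<close> and \<open>s\<^sup>2(1)\<close> do not depend on which minimizer is called
      \<open>\<xi>\<^sub>0\<close>, \<open>\<xi>\<^sub>1\<close>\<close>
    and well_def_0: "\<And>\<eta>. I_optimal \<mu> f \<Xi> 0 \<eta> \<Longrightarrow> MAXBIAS \<mu> f \<eta> = MAXBIAS \<mu> f (\<xi> 0)"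
    and well_def_1: "\<And>\<eta>. I_optimal \<mu> f \<Xi> 1 \<eta> \<Longrightarrow> VAR \<mu> f \<eta> = VAR \<mu> f (\<xi> 1)"
  shows
    "(\<forall>b. (INF \<eta>\<in>\<Xi>. MAXBIAS \<mu> f \<eta>) \<le> ereal (b\<^sup>2) \<and> ereal (b\<^sup>2) \<le> (SUP \<eta>\<in>\<Xi>. MAXBIAS \<mu> f \<eta>) \<longrightarrow>
        (\<forall>\<nu>\<in>{0..1}. ereal (b\<^sup>2) = MAXBIAS \<mu> f (\<xi> \<nu>) \<longrightarrow>
            robust_bounded_bias \<mu> f \<Xi> b (\<xi> \<nu>) \<and>
            (\<forall>\<eta>. robust_bounded_bias \<mu> f \<Xi> b \<eta> \<longrightarrow> I_optimal \<mu> f \<Xi> \<nu> \<eta>)) \<and>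
        (MAXBIAS \<mu> f (\<xi> 0) \<le> ereal (b\<^sup>2) \<longrightarrow>
            robust_bounded_bias \<mu> f \<Xi> b (\<xi> 0) \<and>
            (\<forall>\<eta>. robust_bounded_bias \<mu> f \<Xi> b \<eta> \<longrightarrow> I_optimal \<mu> f \<Xi> 0 \<eta>))) \<and>
     (\<forall>s. (INF \<eta>\<in>\<Xi>. ereal (VAR \<mu> f \<eta>)) \<le> ereal (s\<^sup>2) \<and> ereal (s\<^sup>2) \<le> (SUP \<eta>\<in>\<Xi>. ereal (VAR \<mu> f \<eta>)) \<longrightarrow>
        (\<forall>\<nu>\<in>{0..1}. s\<^sup>2 = VAR \<mu> f (\<xi> \<nu>) \<longrightarrow>
            robust_bounded_variance \<mu> f \<Xi> s (\<xi> \<nu>) \<and>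
            (\<forall>\<eta>. robust_bounded_variance \<mu> f \<Xi> s \<eta> \<longrightarrow> I_optimal \<mu> f \<Xi> \<nu> \<eta>)) \<and>
        (VAR \<mu> f (\<xi> 1) \<le> s\<^sup>2 \<longrightarrow>
            robust_bounded_variance \<mu> f \<Xi> s (\<xi> 1) \<and>
            (\<forall>\<eta>. robust_bounded_variance \<mu> f \<Xi> s \<eta> \<longrightarrow> I_optimal \<mu> f \<Xi> 1 \<eta>)))"
proof (intro conjI allI ballI impI)
  fix b \<nu> :: real
  assume \<nu>: "\<nu> \<in> {0..1}" and b: "ereal (b\<^sup>2) = MAXBIAS \<mu> f (\<xi> \<nu>)"
  have in_\<Xi>: "\<xi> \<nu> \<in> \<Xi>" using opt[OF \<nu>] by (simp add: I_optimal_iff)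
  show "robust_bounded_bias \<mu> f \<Xi> b (\<xi> \<nu>)"
    unfolding robust_bounded_bias_iff
    using in_\<Xi> b VAR_le_if_I_optimal[OF opt[OF \<nu>] \<nu> b[symmetric] _ _ well_def_1] by simp
  show "I_optimal \<mu> f \<Xi> \<nu> \<eta>" if "robust_bounded_bias \<mu> f \<Xi> b \<eta>" for \<eta>
    using that in_\<Xi> b unfolding robust_bounded_bias_iff
    by (intro I_optimal_if_dominates[OF opt[OF \<nu>] \<nu>]) auto
next
  fix b :: real
  assume b: "MAXBIAS \<mu> f (\<xi> 0) \<le> ereal (b\<^sup>2)"
  have opt0: "I_optimal \<mu> f \<Xi> 0 (\<xi> 0)" by (rule opt) simp
  then show "robust_bounded_bias \<mu> f \<Xi> b (\<xi> 0)"
    using b by (simp add: robust_bounded_bias_iff I_optimal_iff I_crit_0)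
  show "I_optimal \<mu> f \<Xi> 0 \<eta>" if "robust_bounded_bias \<mu> f \<Xi> b \<eta>" for \<eta>
    using that opt0 b
    by (intro I_optimal_if_le[OF opt0]) (auto simp: robust_bounded_bias_iff I_optimal_iff I_crit_0)
next
  fix s \<nu> :: real
  assume \<nu>: "\<nu> \<in> {0..1}" and s: "s\<^sup>2 = VAR \<mu> f (\<xi> \<nu>)"
  have in_\<Xi>: "\<xi> \<nu> \<in> \<Xi>" using opt[OF \<nu>] by (simp add: I_optimal_iff)
  show "robust_bounded_variance \<mu> f \<Xi> s (\<xi> \<nu>)"
    unfolding robust_bounded_variance_iff
    using in_\<Xi> s MAXBIAS_le_if_I_optimal[OF opt[OF \<nu>] \<nu> _ _ well_def_0] by simp
  show "I_optimal \<mu> f \<Xi> \<nu> \<eta>" if "robust_bounded_variance \<mu> f \<Xi> s \<eta>" for \<eta>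
    using that in_\<Xi> s unfolding robust_bounded_variance_iff
    by (intro I_optimal_if_dominates[OF opt[OF \<nu>] \<nu>]) auto
next
  fix s :: real
  assume s: "VAR \<mu> f (\<xi> 1) \<le> s\<^sup>2"
  have opt1: "I_optimal \<mu> f \<Xi> 1 (\<xi> 1)" by (rule opt) simp
  then show "robust_bounded_variance \<mu> f \<Xi> s (\<xi> 1)"
    using s by (simp add: robust_bounded_variance_iff I_optimal_iff I_crit_1)
  show "I_optimal \<mu> f \<Xi> 1 \<eta>" if "robust_bounded_variance \<mu> f \<Xi> s \<eta>" for \<eta>
    using that opt1 s
    by (intro I_optimal_if_le[OF opt1]) (auto simp: robust_bounded_variance_iff I_optimal_iff I_crit_1)
qed

end
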